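(* In any minimal counterexample to Hadwiger's Conjecture among graphs with no stable set of size $3$, every vertex lies in some induced subgraph isomorphic to the $5$-cycle $C_5$.
   Context: All graphs are finite and simple. $h(G)$ is the largest $t$ such that $K_t$ is a minor of $G$, and $\chi(G)$ is the chromatic number. A counterexample is a graph $G$ with no stable set of size $3$ and $h(G)<\chi(G)$. A minimal counterexample is a counterexample none of whose proper induced subgraphs is a counterexample. *)

theory Defs
  imports "Graph_Theory.Graph_Theory" "HOL-Library.FuncSet"
begin

text \<open>
  Graphs are those of the locale \<^locale>\<open>graph\<close>: finite digraphs with a symmetric arc relation,
  without loops and without parallel arcs, i.e. finite simple graphs (the null graph is allowed).
  Each undirected edge is a pair of opposite arcs, and \<^const>\<open>arcs_ends\<close> is the adjacency relation.
\<close>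

definition stable_set :: "('a, 'b) pre_digraph \<Rightarrow> 'a set \<Rightarrow> bool" where
  "stable_set G S \<longleftrightarrow> S \<subseteq> verts G \<and> (\<forall>u\<in>S. \<forall>v\<in>S. \<not> u \<rightarrow>\<^bsub>G\<^esub> v)"

definition proper_colouring :: "('a, 'b) pre_digraph \<Rightarrow> nat \<Rightarrow> ('a \<Rightarrow> nat) \<Rightarrow> bool" where
  "proper_colouring G k c \<longleftrightarrow>
     c \<in> verts G \<rightarrow> {..<k} \<and> (\<forall>u\<in>verts G. \<forall>v\<in>verts G. u \<rightarrow>\<^bsub>G\<^esub> v \<longrightarrow> c u \<noteq> c v)"

definition chromatic_number :: "('a, 'b) pre_digraph \<Rightarrow> nat" where
  "chromatic_number G = (LEAST k. \<exists>c. proper_colouring G k c)"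

text \<open>
  A graph M is a minor of G if G contains a model of M: pairwise disjoint connected branch sets,
  one for each vertex of M, such that adjacent vertices of M have branch sets joined by an edge
  of G. Contracting the branch sets and deleting everything superfluous yields M. Branch sets
  are nonempty, since \<^const>\<open>connected\<close> excludes the null graph.
\<close>

definition minor_model ::
    "('c, 'd) pre_digraph \<Rightarrow> ('a, 'b) pre_digraph \<Rightarrow> ('c \<Rightarrow> 'a set) \<Rightarrow> bool" where
  "minor_model M G B \<longleftrightarrow>
     (\<forall>x\<in>verts M. B x \<subseteq> verts G \<and> connected (G \<restriction> B x)) \<and>
     (\<forall>x\<in>verts M. \<forall>y\<in>verts M. x \<noteq> y \<longrightarrow> B x \<inter> B y = {}) \<and>
     (\<forall>x\<in>verts M. \<forall>y\<in>verts M. x \<rightarrow>\<^bsub>M\<^esub> y \<longrightarrow> (\<exists>u\<in>B x. \<exists>v\<in>B y. u \<rightarrow>\<^bsub>G\<^esub> v))"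

definition is_minor :: "('c, 'd) pre_digraph \<Rightarrow> ('a, 'b) pre_digraph \<Rightarrow> bool" where
  "is_minor M G \<longleftrightarrow> (\<exists>B. minor_model M G B)"

definition hadwiger_number :: "('a, 'b) pre_digraph \<Rightarrow> nat" where
  "hadwiger_number G =
     Max {t. \<exists>K :: (nat, nat \<times> nat) pre_digraph. complete_digraph t K \<and> is_minor K G}"

definition counterexample :: "('a, 'b) pre_digraph \<Rightarrow> bool" where
  "counterexample G \<longleftrightarrow>
     graph G \<and> \<not> (\<exists>S. stable_set G S \<and> card S = 3) \<and> hadwiger_number G < chromatic_number G"

definition minimal_counterexample :: "('a, 'b) pre_digraph \<Rightarrow> bool" where
  "minimal_counterexample G \<longleftrightarrow>
     counterexample G \<and> (\<forall>H. induced_subgraph H G \<and> H \<noteq> G \<longrightarrow> \<not> counterexample H)"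

text \<open>The cycle on n vertices (intended for n \<ge> 3).\<close>

definition cycle_graph :: "nat \<Rightarrow> (nat, nat \<times> nat) pre_digraph" where
  "cycle_graph n = with_proj \<lparr> pverts = {..<n},
     parcs = {(i, j). i < n \<and> j < n \<and> (j = Suc i mod n \<or> i = Suc j mod n)} \<rparr>"

text \<open>The minimum and the maximum above are attained for every finite simple graph.\<close>

lemma proper_colouring_exists:
  assumes "graph G"
  shows "\<exists>k c. proper_colouring G k c"
proof -
  interpret graph G by (rule assms)
  obtain c where c: "bij_betw c (verts G) {0..<card (verts G)}"
    using ex_bij_betw_finite_nat[OF finite_verts] by blast
  have "c u \<noteq> c v" if "u \<in> verts G" "v \<in> verts G" "u \<rightarrow>\<^bsub>G\<^esub> v" for u v
    using that c adj_not_same unfolding bij_betw_def inj_on_def by metis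
  moreover have "c \<in> verts G \<rightarrow> {..<card (verts G)}"
    using c by (auto simp: bij_betw_def)
  ultimately show ?thesis unfolding proper_colouring_def by blast
qed

lemma card_le_of_minor_model:
  assumes "finite (verts G)" and m: "minor_model M G B"
  shows "card (verts M) \<le> card (verts G)"
proof -
  have ne: "\<forall>x\<in>verts M. \<exists>u. u \<in> B x"
  proof
    fix x assume "x \<in> verts M"
    then have "connected (G \<restriction> B x)" using m by (auto simp: minor_model_def)
    then show "\<exists>u. u \<in> B x"
      by (auto simp: connected_def strongly_connected_def mk_symmetric_def)
  qed
  then obtain f where f: "\<And>x. x \<in> verts M \<Longrightarrow> f x \<in> B x" by metis
  have "inj_on f (verts M)"
    using f m unfolding inj_on_def minor_model_def by (metis IntI empty_iff)
  moreover have "f ` verts M \<subseteq> verts G" using f m by (auto simp: minor_model_def)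
  ultimately show ?thesis using assms(1) card_inj_on_le by blast
qed

lemma hadwiger_set_finite_nonempty:
  fixes G :: "('a, 'b) pre_digraph"
  assumes "graph G"
  defines "T \<equiv> {t. \<exists>K :: (nat, nat \<times> nat) pre_digraph. complete_digraph t K \<and> is_minor K G}"
  shows "finite T" and "T \<noteq> {}"
proof -
  interpret graph G by (rule assms(1))
  have "T \<subseteq> {..card (verts G)}"
    unfolding T_def is_minor_def complete_digraph_def
    using card_le_of_minor_model[OF finite_verts] by auto
  then show "finite T" using finite_subset by blast
  let ?K = "with_proj \<lparr> pverts = {} :: nat set, parcs = {} \<rparr>"
  have "complete_digraph 0 ?K" by (simp add: complete_digraph_pair_def)
  moreover have "is_minor ?K G" by (auto simp: is_minor_def minor_model_def)
  ultimately show "T \<noteq> {}" unfolding T_def by blast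
qed

end

theory Submission
  imports Defs
begin

text \<open>
  Without stable triples a colouring is a matching of the complement, so the chromatic number is
  the number of vertices minus the maximum size of such a matching. In a minimal counterexample
  every vertex is missed by some maximum matching, and the complement is connected; by Gallai's
  lemma no maximum matching misses two vertices. Hence no edge dominates: if vw were a dominating
  edge, a matching of the rest of G would be maximum in G and miss both v and w.
  The non-neighbours of v form a clique. Its complement is not a clique, since G is not covered by
  two cliques, so v has two non-adjacent neighbours b and c. A common non-neighbour of v and b, and
  one of v and c, complete them to an induced 5-cycle.
\<close>

section \<open>Gallai's lemma\<close>

text \<open>The complement of a graph is only needed through its edges, so a graph is given here by
  a set \<open>E\<close> of two-element sets, and no complement digraph is built.\<close>

definition matching :: "'a set set \<Rightarrow> 'a set set \<Rightarrow> bool" where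
  "matching E M \<longleftrightarrow> M \<subseteq> E \<and> pairwise disjnt M"

definition maximum_matching :: "'a set set \<Rightarrow> 'a set set \<Rightarrow> bool" where
  "maximum_matching E M \<longleftrightarrow> matching E M \<and> (\<forall>N. matching E N \<longrightarrow> card N \<le> card M)"

lemma matching_unique_edge:
  assumes "matching E M" "e \<in> M" "f \<in> M" "x \<in> e" "x \<in> f"
  shows "e = f"
  using assms by (auto simp: matching_def pairwise_def disjnt_def)

lemma card_Union_matching:
  assumes "finite E" "\<And>e. e \<in> E \<Longrightarrow> card e = 2" "matching E M"
  shows "card (\<Union>M) = 2 * card M"
proof -
  have M: "M \<subseteq> E" "pairwise disjnt M" using assms(3) by (auto simp: matching_def)
  have "finite e" if "e \<in> M" for e
    using that M(1) assms(2) card.infinite by fastforce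
  then have "card (\<Union>M) = sum card M" using M(2) by (intro card_Union_disjoint)
  also have "\<dots> = (\<Sum>e\<in>M. 2)" using M(1) assms(2) by (intro sum.cong) auto
  finally show ?thesis by simp
qed

text \<open>
  The relation ``no maximum matching misses both endpoints'' is transitive. Among the maximum
  matchings N missing t, one that agrees with M as much as possible is considered: if M missed u
  and v, then N could be switched to agree with M on one more edge.
\<close>
lemma gallai_transitive:
  assumes fin: "finite E" and edge: "\<And>e. e \<in> E \<Longrightarrow> card e = 2"
    and t: "\<exists>N. maximum_matching E N \<and> t \<notin> \<Union>N"
    and ut: "\<And>N. maximum_matching E N \<Longrightarrow> u \<in> \<Union>N \<or> t \<in> \<Union>N"
    and tv: "\<And>N. maximum_matching E N \<Longrightarrow> t \<in> \<Union>N \<or> v \<in> \<Union>N"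
    and "u \<noteq> v" and M: "maximum_matching E M"
  shows "u \<in> \<Union>M \<or> v \<in> \<Union>M"
proof (rule ccontr)
  assume miss: "\<not> ?thesis"
  define \<N> where "\<N> = {N. maximum_matching E N \<and> t \<notin> \<Union>N}"
  have "\<N> \<subseteq> Pow E" by (auto simp: \<N>_def maximum_matching_def matching_def)
  then have "finite \<N>" using fin by (auto intro: finite_subset)
  moreover have "\<N> \<noteq> {}" using t by (auto simp: \<N>_def)
  ultimately have "Max ((\<lambda>N. card (M \<inter> N)) ` \<N>) \<in> (\<lambda>N. card (M \<inter> N)) ` \<N>" by simp
  then obtain N where "N \<in> \<N>" and best: "\<And>N'. N' \<in> \<N> \<Longrightarrow> card (M \<inter> N') \<le> card (M \<inter> N)"
    using \<open>finite \<N>\<close> by (metis (no_types, lifting) Max_ge finite_imageI imageE image_eqI)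
  then have N: "maximum_matching E N" "t \<notin> \<Union>N" by (auto simp: \<N>_def)
  have MM: "matching E M" and NM: "matching E N" and card_eq: "card M = card N"
    using M N by (auto simp: maximum_matching_def intro: antisym)
  have sub: "M \<subseteq> E" "N \<subseteq> E" using MM NM by (auto simp: matching_def)
  then have finMN: "finite M" "finite N" using fin by (auto intro: finite_subset)
  have "finite e" if "e \<in> E" for e using edge[OF that] card.infinite by fastforce
  then have finU: "finite (\<Union>M)" "finite (\<Union>N)" using finMN sub by auto
  \<comment> \<open>Both matchings cover equally many vertices. As \<open>u\<close> and
    \<open>v\<close> are covered by \<open>N\<close> only, at least two vertices are covered by
    \<open>M\<close> only, and one of them, \<open>x\<close>, differs from \<open>t\<close>.\<close>
  have "card (\<Union>M) = card (\<Union>N)"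
    using card_Union_matching[OF fin edge] MM NM card_eq by simp
  then have "card (\<Union>M - \<Union>N) = card (\<Union>N - \<Union>M)"
    using finU by (simp add: card_Diff_subset_Int Int_commute)
  moreover have "{u, v} \<subseteq> \<Union>N - \<Union>M" using ut[OF N(1)] tv[OF N(1)] N(2) miss by auto
  then have "card {u, v} \<le> card (\<Union>N - \<Union>M)" using finU by (intro card_mono) auto
  ultimately have "2 \<le> card (\<Union>M - \<Union>N)" using \<open>u \<noteq> v\<close> by simp
  then have "\<not> \<Union>M - \<Union>N \<subseteq> {t}"
    using card_mono[of "{t}" "\<Union>M - \<Union>N"] by auto
  then obtain x e where x: "x \<notin> \<Union>N" "x \<noteq> t" "e \<in> M" "x \<in> e" by blast
  have "card e = 2" using edge sub x by blast
  then obtain y where e: "e = {x, y}" "x \<noteq> y" using x(4) by (auto simp: card_2_iff)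
  have "e \<notin> N" using x by blast
  have "y \<in> \<Union>N"
  proof (rule ccontr)
    assume "y \<notin> \<Union>N"
    then have "matching E (insert e N)"
      using NM x e sub by (auto simp: matching_def pairwise_insert disjnt_def)
    then have "card (insert e N) \<le> card N" using N(1) by (auto simp: maximum_matching_def)
    then show False using \<open>e \<notin> N\<close> finMN by simp
  qed
  then obtain f where f: "f \<in> N" "y \<in> f" by blast
  have "f \<notin> M" using matching_unique_edge[OF MM _ x(3), of f y] f e x by auto
  \<comment> \<open>The exchange keeps the size, and \<open>t\<close> stays missed: it is neither
    \<open>x\<close> nor the vertex \<open>y\<close>, which \<open>N\<close> covers. The overlap
    with \<open>M\<close> gains \<open>e\<close> and loses nothing because \<open>f\<close> is not
    in \<open>M\<close>, contrary to the choice of \<open>N\<close>.\<close>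
  let ?N' = "insert e (N - {f})"
  have "matching E ?N'"
    using NM x e f sub by (auto simp: matching_def pairwise_insert pairwise_def disjnt_def)
  moreover have "0 < card N" using finMN f by (auto simp: card_gt_0_iff)
  then have "card ?N' = card N" using \<open>e \<notin> N\<close> finMN f by simp
  ultimately have "maximum_matching E ?N'" using N(1) by (simp add: maximum_matching_def)
  moreover have "t \<notin> \<Union>?N'" using N(2) x e f by auto
  ultimately have "card (M \<inter> ?N') \<le> card (M \<inter> N)" by (intro best) (simp add: \<N>_def)
  moreover have "M \<inter> ?N' = insert e (M \<inter> N)" using x \<open>f \<notin> M\<close> by auto
  ultimately show False using \<open>e \<notin> N\<close> finMN by simp
qed

section \<open>Colourings and matchings of the complement\<close>

text \<open>The edge set of the complement of the subgraph induced on \<open>S\<close>. With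
  \<open>S\<close> as a parameter, matchings found in a smaller vertex set can be used in a larger
  one.\<close>

definition nonedges :: "('a, 'b) pre_digraph \<Rightarrow> 'a set \<Rightarrow> 'a set set" where
  "nonedges G S = {{x, y} | x y. x \<in> S \<and> y \<in> S \<and> x \<noteq> y \<and> \<not> x \<rightarrow>\<^bsub>G\<^esub> y}"

lemma nonedges_mono: "S \<subseteq> T \<Longrightarrow> nonedges G S \<subseteq> nonedges G T"
  by (auto simp: nonedges_def)

lemma card_nonedge: "e \<in> nonedges G S \<Longrightarrow> card e = 2"
  by (auto simp: nonedges_def)

lemma finite_nonedges: "finite S \<Longrightarrow> finite (nonedges G S)"
  by (rule finite_subset[of _ "Pow S"]) (auto simp: nonedges_def)

lemma (in graph) adj_sym: "u \<rightarrow> w \<Longrightarrow> w \<rightarrow> u"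
  using arcs_ends_symmetric[OF sym_arcs] .

lemma (in graph) nonedge_iff:
  "{x, y} \<in> nonedges G S \<longleftrightarrow> x \<in> S \<and> y \<in> S \<and> x \<noteq> y \<and> \<not> x \<rightarrow> y"
  by (auto simp: nonedges_def doubleton_eq_iff dest: adj_sym)

text \<open>Colours may come from any type: the finitely many values used are renumbered as an
  initial segment of the naturals.\<close>

lemma (in graph) chromatic_number_le_image:
  assumes "\<And>x y. x \<in> verts G \<Longrightarrow> y \<in> verts G \<Longrightarrow> x \<rightarrow> y \<Longrightarrow> r x \<noteq> r y"
  shows "chromatic_number G \<le> card (r ` verts G)"
proof -
  obtain h where h: "bij_betw h (r ` verts G) {0..<card (r ` verts G)}"
    using ex_bij_betw_finite_nat[of "r ` verts G"] by auto
  have "proper_colouring G (card (r ` verts G)) (h \<circ> r)"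
    unfolding proper_colouring_def
  proof (intro conjI ballI impI)
    show "h \<circ> r \<in> verts G \<rightarrow> {..<card (r ` verts G)}"
      using h by (auto simp: bij_betw_def)
    show "(h \<circ> r) u \<noteq> (h \<circ> r) w" if "u \<in> verts G" "w \<in> verts G" "u \<rightarrow> w" for u w
      using assms[OF that] that h by (auto simp: bij_betw_def inj_on_def)
  qed
  then show ?thesis unfolding chromatic_number_def by (blast intro: Least_le)
qed

text \<open>The edges of \<open>M\<close> together with the singletons of the unmatched vertices are
  the classes of a proper colouring, in which each edge of \<open>M\<close> saves one
  colour.\<close>

lemma (in graph) chromatic_number_matching_le:
  assumes M: "matching (nonedges G (verts G)) M"
  shows "chromatic_number G + card M \<le> card (verts G)"
proof -
  \<comment> \<open>The colour of \<open>x\<close> is the edge of \<open>M\<close> at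
    \<open>x\<close> if there is one, and \<open>{x}\<close> otherwise.\<close>
  define r where "r x = insert x (\<Union>{e \<in> M. x \<in> e})" for x
  have sub: "M \<subseteq> nonedges G (verts G)" using M by (simp add: matching_def)
  then have finM: "finite M" using finite_nonedges[OF finite_verts] by (rule finite_subset)
  have UM: "\<Union>M \<subseteq> verts G" using sub by (auto simp: nonedges_def)
  have card_UM: "card (\<Union>M) = 2 * card M"
    using finite_nonedges[OF finite_verts] card_nonedge M by (rule card_Union_matching)
  have "r x \<noteq> r y" if "x \<rightarrow> y" for x y
  proof
    assume "r x = r y"
    moreover have "x \<noteq> y" using that adj_not_same by blast
    ultimately obtain e where e: "e \<in> M" "x \<in> e" "y \<in> e" by (auto simp: r_def)
    then obtain a b where "e = {a, b}" "\<not> a \<rightarrow> b" using sub by (auto simp: nonedges_def)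
    then show False using e that \<open>x \<noteq> y\<close> adj_sym by auto
  qed
  then have "chromatic_number G \<le> card (r ` verts G)" by (intro chromatic_number_le_image)
  also have "\<dots> \<le> card (M \<union> (\<lambda>x. {x}) ` (verts G - \<Union>M))"
  proof (rule card_mono)
    show "finite (M \<union> (\<lambda>x. {x}) ` (verts G - \<Union>M))" using finM by simp
    have "r x \<in> M" if "e \<in> M" "x \<in> e" for x e
    proof -
      have "{e \<in> M. x \<in> e} = {e}" using matching_unique_edge[OF M] that by blast
      then show ?thesis using that by (simp add: r_def insert_absorb)
    qed
    moreover have "r x = {x}" if "x \<notin> \<Union>M" for x using that by (auto simp: r_def)
    ultimately show "r ` verts G \<subseteq> M \<union> (\<lambda>x. {x}) ` (verts G - \<Union>M)" by blast
  qed
  also have "\<dots> \<le> card M + card (verts G - \<Union>M)"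
    by (rule order_trans[OF card_Un_le]) (simp add: card_image_le)
  also have "card (verts G - \<Union>M) = card (verts G) - 2 * card M"
    using UM card_UM by (simp add: card_Diff_subset finite_subset)
  finally have "chromatic_number G \<le> card M + (card (verts G) - 2 * card M)" .
  moreover have "2 * card M \<le> card (verts G)"
    using card_mono[OF finite_verts UM] card_UM by simp
  ultimately show ?thesis by simp
qed

text \<open>The classes of an optimal colouring are stable, so they have at most two vertices. Those
  with two are disjoint edges of the complement, and each accounts for one vertex beyond the number
  of colours.\<close>

lemma (in graph) matching_from_colouring:
  assumes no3: "\<not> (\<exists>S. stable_set G S \<and> card S = 3)"
  shows "\<exists>M. matching (nonedges G (verts G)) M \<and> card (verts G) \<le> card M + chromatic_number G"
proof -
  define k where "k = chromatic_number G"
  have "\<exists>c. proper_colouring G k c"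
    unfolding k_def chromatic_number_def
    using proper_colouring_exists[OF graph_axioms] by (rule LeastI_ex)
  then obtain c where c: "c \<in> verts G \<rightarrow> {..<k}"
    and proper: "\<And>u w. u \<in> verts G \<Longrightarrow> w \<in> verts G \<Longrightarrow> u \<rightarrow> w \<Longrightarrow> c u \<noteq> c w"
    by (auto simp: proper_colouring_def)
  define cls where "cls i = {x \<in> verts G. c x = i}" for i
  have le2: "card (cls i) \<le> 2" for i
  proof (rule ccontr)
    assume "\<not> card (cls i) \<le> 2"
    then obtain T where T: "T \<subseteq> cls i" "card T = 3"
      using obtain_subset_with_card_n[of 3 "cls i"] by auto
    then have "x \<in> verts G \<and> c x = i" if "x \<in> T" for x using that by (auto simp: cls_def)
    then have "stable_set G T" using proper unfolding stable_set_def by (metis subsetI)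
    then show False using no3 T by blast
  qed
  define I where "I = {i. i < k \<and> card (cls i) = 2}"
  \<comment> \<open>Empty classes could coincide for different colours; those indexed by
    \<open>I\<close> are nonempty, so \<open>card I\<close> counts the edges of the
    matching.\<close>
  have inj: "inj_on cls I"
  proof (rule inj_onI)
    fix i j assume "i \<in> I" "j \<in> I" "cls i = cls j"
    moreover from \<open>i \<in> I\<close> have "cls i \<noteq> {}" by (auto simp: I_def)
    ultimately show "i = j" by (auto simp: cls_def)
  qed
  have "cls i \<in> nonedges G (verts G)" if "i \<in> I" for i
  proof -
    have "card (cls i) = 2" using that by (simp add: I_def)
    then obtain x y where xy: "cls i = {x, y}" "x \<noteq> y" by (meson card_2_iff)
    then have "x \<in> cls i" "y \<in> cls i" by auto
    then have "x \<in> verts G" "y \<in> verts G" "\<not> x \<rightarrow> y"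
      using proper[of x y] by (auto simp: cls_def)
    then show ?thesis using xy by (simp add: nonedge_iff)
  qed
  then have "matching (nonedges G (verts G)) (cls ` I)"
    by (auto simp: matching_def pairwise_def disjnt_def cls_def)
  moreover have "card (verts G) = card (\<Union>i<k. cls i)"
    by (rule arg_cong[of _ _ card]) (use c in \<open>auto simp: cls_def\<close>)
  then have "card (verts G) \<le> (\<Sum>i<k. card (cls i))" using card_UN_le[of "{..<k}" cls] by simp
  moreover have "(\<Sum>i<k. card (cls i)) \<le> (\<Sum>i<k. 1 + (if i \<in> I then 1 else 0))"
  proof (rule sum_mono)
    fix i assume "i \<in> {..<k}"
    then show "card (cls i) \<le> 1 + (if i \<in> I then 1 else 0)" using le2[of i] by (auto simp: I_def)
  qed
  moreover have "(\<Sum>i<k. 1 + (if i \<in> I then 1 else 0)) = k + card I"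
  proof -
    have "{..<k} \<inter> I = I" by (auto simp: I_def)
    then show ?thesis by (subst sum.distrib) (simp add: sum.If_cases)
  qed
  moreover have "card (cls ` I) = card I" using inj by (rule card_image)
  ultimately show ?thesis unfolding k_def by (intro exI[of _ "cls ` I"]) auto
qed

section \<open>Models of complete graphs\<close>

text \<open>A model of a complete graph on \<open>card F\<close> vertices, kept as a set of branch
  sets rather than an indexed family: models in disjoint parts can then be united, and a branch set
  can be inserted.\<close>

definition clique_model :: "('a, 'b) pre_digraph \<Rightarrow> 'a set \<Rightarrow> 'a set set \<Rightarrow> bool" where
  "clique_model G S F \<longleftrightarrow>
     (\<forall>B\<in>F. B \<subseteq> S \<and> connected (G \<restriction> B)) \<and> pairwise disjnt F \<and>
     (\<forall>B\<in>F. \<forall>C\<in>F. B \<noteq> C \<longrightarrow> (\<exists>u\<in>B. \<exists>w\<in>C. u \<rightarrow>\<^bsub>G\<^esub> w))"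

lemma clique_model_mono: "clique_model G S F \<Longrightarrow> S \<subseteq> T \<Longrightarrow> clique_model G T F"
  by (fastforce simp: clique_model_def)

lemma connected_nonempty: "connected (G \<restriction> B) \<Longrightarrow> B \<noteq> {}"
  by (auto simp: connected_def strongly_connected_def)

lemma finite_clique_model: "clique_model G S F \<Longrightarrow> finite S \<Longrightarrow> finite F"
  by (rule finite_subset[of _ "Pow S"]) (auto simp: clique_model_def)

lemma (in graph) card_clique_model_le:
  assumes F: "clique_model G (verts G) F"
  shows "card F \<le> hadwiger_number G"
proof -
  have "finite F" using F finite_verts by (rule finite_clique_model)
  then obtain h where h: "bij_betw h {0..<card F} F" using ex_bij_betw_nat_finite by blast
  define K :: "(nat, nat \<times> nat) pre_digraph" where "K = with_proj
    \<lparr> pverts = {0..<card F}, parcs = {(i, j). i < card F \<and> j < card F \<and> i \<noteq> j} \<rparr>"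
  have "complete_digraph (card F) K" by (auto simp: K_def complete_digraph_pair_def)
  moreover have "minor_model K G h"
  proof -
    have hF: "h i \<in> F" if "i < card F" for i using h that by (auto simp: bij_betw_def)
    have hinj: "h i \<noteq> h j" if "i < card F" "j < card F" "i \<noteq> j" for i j
      using h that by (auto simp: bij_betw_def inj_on_def)
    show ?thesis
      unfolding minor_model_def
      using F hF hinj by (auto simp: K_def clique_model_def pairwise_def disjnt_def)
  qed
  ultimately have "card F \<in>
      {t. \<exists>K :: (nat, nat \<times> nat) pre_digraph. complete_digraph t K \<and> is_minor K G}"
    by (auto simp: is_minor_def)
  then show ?thesis
    unfolding hadwiger_number_def
    using hadwiger_set_finite_nonempty(1)[OF graph_axioms] by (intro Max_ge)
qed

text \<open>Branch sets are nonempty and disjoint, so the branch map of a largest complete minor is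
  injective and its image is as large as the minor.\<close>

lemma (in graph) clique_model_attained:
  shows "\<exists>F. clique_model G (verts G) F \<and> card F = hadwiger_number G"
proof -
  have "hadwiger_number G \<in>
      {t. \<exists>K :: (nat, nat \<times> nat) pre_digraph. complete_digraph t K \<and> is_minor K G}"
    unfolding hadwiger_number_def
    using hadwiger_set_finite_nonempty[OF graph_axioms] by (rule Max_in)
  then obtain K :: "(nat, nat \<times> nat) pre_digraph" and B
    where K: "complete_digraph (hadwiger_number G) K" and B: "minor_model K G B"
    by (auto simp: is_minor_def)
  have adjK: "x \<rightarrow>\<^bsub>K\<^esub> y \<longleftrightarrow> x \<in> verts K \<and> y \<in> verts K \<and> x \<noteq> y" for x y
    using K by (auto simp: complete_digraph_def)
  have "B x \<noteq> {}" if "x \<in> verts K" for x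
    using B that connected_nonempty by (auto simp: minor_model_def)
  then have "inj_on B (verts K)" using B unfolding minor_model_def inj_on_def by (metis Int_absorb)
  then have "card (B ` verts K) = hadwiger_number G"
    using K by (simp add: card_image complete_digraph_def)
  moreover have "clique_model G (verts G) (B ` verts K)"
    unfolding clique_model_def
  proof (intro conjI ballI impI)
    show "pairwise disjnt (B ` verts K)"
      using B by (intro pairwise_imageI) (simp add: disjnt_def minor_model_def)
  next
    fix X Y assume "X \<in> B ` verts K" "Y \<in> B ` verts K" "X \<noteq> Y"
    then show "\<exists>u\<in>X. \<exists>w\<in>Y. u \<rightarrow> w" using B by (auto simp: minor_model_def adjK)
  qed (use B in \<open>auto simp: minor_model_def\<close>)
  ultimately show ?thesis by blast
qed

text \<open>Needed for the new branch sets, which are single vertices and edges.\<close>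

lemma (in graph) connected_clique:
  assumes "S \<subseteq> verts G" "S \<noteq> {}" and cl: "\<And>u w. u \<in> S \<Longrightarrow> w \<in> S \<Longrightarrow> u \<noteq> w \<Longrightarrow> u \<rightarrow> w"
  shows "connected (G \<restriction> S)"
proof -
  interpret H: wf_digraph "G \<restriction> S" by (rule wf_digraphI_induced[OF induced_induce[OF assms(1)]])
  have "u \<rightarrow>\<^sup>*\<^bsub>G \<restriction> S\<^esub> w" if "u \<in> S" "w \<in> S" for u w
  proof (cases "u = w")
    case False
    then have "u \<rightarrow>\<^bsub>G \<restriction> S\<^esub> w" using cl that by (fastforce simp: arcs_ends_conv)
    then show ?thesis by simp
  qed (use that in simp)
  then show ?thesis
    using assms(2) H.reachable_mk_symmetricI by (auto simp: connected_def strongly_connected_def)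
qed

section \<open>Minimal counterexamples\<close>

lemma adj_induce: "u \<rightarrow>\<^bsub>G \<restriction> S\<^esub> w \<longleftrightarrow> u \<in> S \<and> w \<in> S \<and> u \<rightarrow>\<^bsub>G\<^esub> w"
  by (auto simp: arcs_ends_conv)

lemma induce_induce: "B \<subseteq> S \<Longrightarrow> (G \<restriction> S) \<restriction> B = G \<restriction> B"
  by (auto simp: induce_subgraph_def)

lemma nonedges_induce: "nonedges (G \<restriction> S) S = nonedges G S"
  by (auto simp: nonedges_def adj_induce)

lemma clique_model_induce: "clique_model (G \<restriction> S) S F \<longleftrightarrow> clique_model G S F"
\<comment> \<open>If a member of \<open>F\<close> leaves \<open>S\<close>, both sides are false;
  otherwise restricting first to \<open>S\<close> changes nothing.\<close>
proof (cases "\<forall>B\<in>F. B \<subseteq> S")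
  case True
  then have "(\<exists>u\<in>B. \<exists>w\<in>C. u \<rightarrow>\<^bsub>G \<restriction> S\<^esub> w) \<longleftrightarrow> (\<exists>u\<in>B. \<exists>w\<in>C. u \<rightarrow>\<^bsub>G\<^esub> w)"
    if "B \<in> F" "C \<in> F" for B C
    using that by (auto simp: adj_induce subset_iff)
  then show ?thesis using True by (simp add: clique_model_def induce_induce cong: ball_cong)
qed (auto simp: clique_model_def)

lemma (in graph) graph_induce:
  assumes "S \<subseteq> verts G"
  shows "graph (G \<restriction> S)"
proof -
  interpret H: digraph "G \<restriction> S" by (rule digraphI_induced[OF induced_induce[OF assms]])
  have "symmetric (G \<restriction> S)" unfolding symmetric_def by (rule symI) (auto simp: adj_induce adj_sym)
  then show ?thesis by (rule H.graphI)
qed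

section \<open>Models and matchings in a minimal counterexample\<close>

locale min_counterexample = graph +
  assumes minimal: "minimal_counterexample G"
begin

lemma no_stable_triple:
  assumes "x \<in> verts G" "y \<in> verts G" "z \<in> verts G" "x \<noteq> y" "x \<noteq> z" "y \<noteq> z"
  shows "x \<rightarrow> y \<or> x \<rightarrow> z \<or> y \<rightarrow> z"
proof (rule ccontr)
  assume "\<not> ?thesis"
  then have "stable_set G {x, y, z}"
    using assms adj_sym adj_not_same by (auto simp: stable_set_def)
  moreover have "card {x, y, z} = 3" using assms by simp
  ultimately show False using minimal by (auto simp: minimal_counterexample_def counterexample_def)
qed

text \<open>With n vertices, \<open>card F\<close> \<le> h(G) < \<chi>(G) \<le> n -
  \<open>card M\<close>. From here on h(G) < \<chi>(G) enters only through this inequality.\<close>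

lemma model_matching_less:
  assumes "clique_model G (verts G) F" "matching (nonedges G (verts G)) M"
  shows "card F + card M < card (verts G)"
  using card_clique_model_le[OF assms(1)] chromatic_number_matching_le[OF assms(2)] minimal
  by (auto simp: minimal_counterexample_def counterexample_def)

text \<open>The opposite inequality, for proper subsets: the induced subgraph still has no stable
  triple, so by minimality its chromatic number is at most its Hadwiger number. A colouring and a
  largest complete minor supply \<open>M\<close> and \<open>F\<close>.\<close>

lemma proper_subset_model_matching:
  assumes S: "S \<subseteq> verts G" "S \<noteq> verts G"
  obtains F M where "clique_model G S F" "matching (nonedges G S) M" "card S \<le> card F + card M"
proof -
  let ?H = "G \<restriction> S"
  interpret H: graph ?H by (rule graph_induce[OF S(1)])
  have no3: "\<not> (\<exists>T. stable_set ?H T \<and> card T = 3)"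
  proof
    assume "\<exists>T. stable_set ?H T \<and> card T = 3"
    then obtain T where "stable_set ?H T" "card T = 3" by blast
    moreover from this have "stable_set G T"
      using S(1) by (auto simp: stable_set_def adj_induce subset_iff)
    ultimately show False
      using minimal by (auto simp: minimal_counterexample_def counterexample_def)
  qed
  have "?H \<noteq> G" using S(2) by (metis induce_subgraph_verts)
  then have "\<not> counterexample ?H"
    using minimal induced_induce[OF S(1)] by (auto simp: minimal_counterexample_def)
  then have "chromatic_number ?H \<le> hadwiger_number ?H"
    using no3 H.graph_axioms by (simp add: counterexample_def)
  then show ?thesis
    using H.matching_from_colouring[OF no3] H.clique_model_attained that
    by (fastforce simp: nonedges_induce clique_model_induce)
qed

section \<open>Maximum matchings of the complement\<close>

abbreviation "E \<equiv> nonedges G (verts G)"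

lemma finite_E: "finite E"
  by (rule finite_nonedges[OF finite_verts])

text \<open>Deleting \<open>v\<close> from a graph on n vertices gives \<open>F\<close> and
  \<open>M\<close> with sizes adding up to at least n - 1. Since \<open>F\<close> is also a model in
  G, no matching of G can exceed \<open>M\<close>, which avoids \<open>v\<close>.\<close>

lemma missed_by_maximum:
  assumes "v \<in> verts G"
  shows "\<exists>M. maximum_matching E M \<and> v \<notin> \<Union>M"
proof -
  let ?S = "verts G - {v}"
  obtain F M where F: "clique_model G ?S F" and M: "matching (nonedges G ?S) M"
    and c: "card ?S \<le> card F + card M"
    using proper_subset_model_matching[of ?S] assms by blast
  have "clique_model G (verts G) F" using F by (rule clique_model_mono) auto
  then have "card N \<le> card M" if "matching E N" for N
    using model_matching_less[OF _ that] c assms by fastforce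
  moreover have "matching E M" using M nonedges_mono[of ?S] by (fastforce simp: matching_def)
  moreover have "v \<notin> \<Union>M" using M by (auto simp: matching_def nonedges_def)
  ultimately show ?thesis by (auto simp: maximum_matching_def)
qed

lemma maximum_matching_meets_nonedge:
  assumes "{u, w} \<in> E" "maximum_matching E M"
  shows "u \<in> \<Union>M \<or> w \<in> \<Union>M"
proof (rule ccontr)
  assume *: "\<not> ?thesis"
  then have "matching E (insert {u, w} M)"
    using assms by (auto simp: maximum_matching_def matching_def pairwise_insert disjnt_def)
  then have "card (insert {u, w} M) \<le> card M" using assms by (auto simp: maximum_matching_def)
  moreover have "finite M"
    using assms finite_E by (auto simp: maximum_matching_def matching_def intro: finite_subset)
  moreover have "{u, w} \<notin> M" using * by blast
  ultimately show False by simp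
qed

text \<open>Otherwise G would be the join of two smaller graphs, and models in the two add up.\<close>
lemma maximum_matching_misses_one:
  assumes "v \<in> verts G" "w \<in> verts G" "v \<noteq> w" "maximum_matching E M"
  shows "v \<in> \<Union>M \<or> w \<in> \<Union>M"
proof -
  \<comment> \<open>The class of \<open>v\<close> under the relation of never being missed together.
    It will turn out to be the whole vertex set.\<close>
  define C where "C = {u \<in> verts G. u = v \<or>
    (\<forall>N. maximum_matching E N \<longrightarrow> v \<in> \<Union>N \<or> u \<in> \<Union>N)}"
  let ?D = "verts G - C"
  have "v \<in> C" "C \<subseteq> verts G" using assms(1) by (auto simp: C_def)
  \<comment> \<open>A non-edge is never missed at both ends, since it could be added to the
    matching. So a non-neighbour \<open>y\<close> of \<open>x\<close> is related to
    \<open>x\<close>, and Gallai's lemma with \<open>x\<close> in the middle puts \<open>y\<close>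
    into \<open>C\<close>.\<close>
  have join: "x \<rightarrow> y" if "x \<in> C" "y \<in> ?D" for x y
  proof (rule ccontr)
    assume "\<not> x \<rightarrow> y"
    then have xy: "{x, y} \<in> E" using that \<open>C \<subseteq> verts G\<close> by (auto simp: nonedge_iff)
    have "y \<noteq> v" using that \<open>v \<in> C\<close> by blast
    have "v \<in> \<Union>N \<or> y \<in> \<Union>N" if N: "maximum_matching E N" for N
    proof (cases "x = v")
      case True
      then show ?thesis using maximum_matching_meets_nonedge[OF xy N] by simp
    next
      case False
      show ?thesis
      proof (rule gallai_transitive[OF finite_E card_nonedge, where t = x])
        show "\<exists>N. maximum_matching E N \<and> x \<notin> \<Union>N"
          using missed_by_maximum \<open>x \<in> C\<close> \<open>C \<subseteq> verts G\<close> by blast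
        show "v \<in> \<Union>N \<or> x \<in> \<Union>N" if "maximum_matching E N" for N
          using \<open>x \<in> C\<close> False that by (auto simp: C_def)
        show "x \<in> \<Union>N \<or> y \<in> \<Union>N" if "maximum_matching E N" for N
          using maximum_matching_meets_nonedge[OF xy that] .
      qed (use N \<open>y \<noteq> v\<close> in auto)
    qed
    then have "y \<in> C" using that by (auto simp: C_def)
    then show False using that by blast
  qed
  have "C = verts G"
  proof (rule ccontr)
    assume "C \<noteq> verts G"
    then obtain F1 M1 where 1: "clique_model G C F1" "matching (nonedges G C) M1"
      "card C \<le> card F1 + card M1"
      using proper_subset_model_matching[OF \<open>C \<subseteq> verts G\<close>] by blast
    have "?D \<noteq> verts G" using \<open>v \<in> C\<close> assms(1) by blast
    then obtain F2 M2 where 2: "clique_model G ?D F2" "matching (nonedges G ?D) M2"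
      "card ?D \<le> card F2 + card M2"
      using proper_subset_model_matching[of ?D] by blast
    have sub: "\<Union>F1 \<subseteq> C" "\<Union>F2 \<subseteq> ?D" "\<Union>M1 \<subseteq> C" "\<Union>M2 \<subseteq> ?D"
      using 1 2 by (auto simp: clique_model_def matching_def nonedges_def)
    \<comment> \<open>Nonempty branch sets on the two sides are joined by an edge. Nonemptiness also
      keeps the two families disjoint, as only the empty set could lie in both; hence their sizes
      add.\<close>
    have ne: "B \<noteq> {}" if "B \<in> F1 \<union> F2" for B
      using 1 2 that connected_nonempty by (auto simp: clique_model_def)
    have neM: "B \<noteq> {}" if "B \<in> M1 \<union> M2" for B
      using 1 2 that by (auto simp: matching_def nonedges_def)
    have adj: "\<exists>x\<in>B1. \<exists>y\<in>B2. x \<rightarrow> y \<and> y \<rightarrow> x" if "B1 \<in> F1" "B2 \<in> F2" for B1 B2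
      using that ne sub join adj_sym by (meson UnCI UnionI all_not_in_conv subsetD)
    have cross: "disjnt B1 B2" if "B1 \<subseteq> C" "B2 \<subseteq> ?D" for B1 B2
      using that by (auto simp: disjnt_def)
    have pairwise_cross: "pairwise disjnt (P \<union> Q)"
      if "pairwise disjnt P" "pairwise disjnt Q" "\<Union>P \<subseteq> C" "\<Union>Q \<subseteq> ?D" for P Q
    proof (rule pairwiseI)
      fix X Y assume "X \<in> P \<union> Q" "Y \<in> P \<union> Q" "X \<noteq> Y"
      moreover have "disjnt X Y" if "X \<in> P" "Y \<in> Q" for X Y
        using cross that \<open>\<Union>P \<subseteq> C\<close> \<open>\<Union>Q \<subseteq> ?D\<close> by (simp add: Union_subsetI Sup_le_iff)
      ultimately show "disjnt X Y"
        using that(1,2) by (elim UnE) (simp_all add: pairwiseD disjnt_sym)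
    qed
    have "clique_model G (verts G) (F1 \<union> F2)"
      unfolding clique_model_def
    proof (intro conjI ballI impI)
      fix B assume "B \<in> F1 \<union> F2"
      then show "B \<subseteq> verts G" "connected (G \<restriction> B)"
        using 1 2 \<open>C \<subseteq> verts G\<close> by (auto simp: clique_model_def)
    next
      show "pairwise disjnt (F1 \<union> F2)"
        using 1(1) 2(1) sub by (intro pairwise_cross) (auto simp: clique_model_def)
    next
      fix B1 B2 assume "B1 \<in> F1 \<union> F2" "B2 \<in> F1 \<union> F2" "B1 \<noteq> B2"
      moreover have "\<exists>x\<in>B1. \<exists>y\<in>B2. x \<rightarrow> y" if "B1 \<in> F1" "B2 \<in> F1" "B1 \<noteq> B2"
        using 1(1) that by (simp add: clique_model_def)
      moreover have "\<exists>x\<in>B1. \<exists>y\<in>B2. x \<rightarrow> y" if "B1 \<in> F2" "B2 \<in> F2" "B1 \<noteq> B2"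
        using 2(1) that by (simp add: clique_model_def)
      moreover have "\<exists>x\<in>B1. \<exists>y\<in>B2. x \<rightarrow> y" if "B1 \<in> F1" "B2 \<in> F2"
        using adj[OF that] by blast
      moreover have "\<exists>x\<in>B1. \<exists>y\<in>B2. x \<rightarrow> y" if "B2 \<in> F1" "B1 \<in> F2"
        using adj[OF that] by blast
      ultimately show "\<exists>x\<in>B1. \<exists>y\<in>B2. x \<rightarrow> y" by (elim UnE) simp_all
    qed
    moreover have "matching E (M1 \<union> M2)"
    proof -
      have "M1 \<union> M2 \<subseteq> E"
        using 1(2) 2(2) nonedges_mono[OF \<open>C \<subseteq> verts G\<close>, of G] nonedges_mono[of ?D "verts G" G]
        unfolding matching_def by blast
      then show ?thesis
        using 1(2) 2(2) sub by (simp add: matching_def pairwise_cross)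
    qed
    ultimately have "card (F1 \<union> F2) + card (M1 \<union> M2) < card (verts G)"
      by (rule model_matching_less)
    moreover have "card (F1 \<union> F2) = card F1 + card F2"
    proof (rule card_Un_disjoint)
      show "finite F1"
        using 1(1) finite_subset[OF \<open>C \<subseteq> verts G\<close> finite_verts] by (rule finite_clique_model)
      show "finite F2" using 2(1) by (rule finite_clique_model) simp
      show "F1 \<inter> F2 = {}" using ne sub by blast
    qed
    moreover have "card (M1 \<union> M2) = card M1 + card M2"
    proof (rule card_Un_disjoint)
      show "finite M1" "finite M2"
        using \<open>matching E (M1 \<union> M2)\<close> finite_E by (auto simp: matching_def intro: finite_subset)
      show "M1 \<inter> M2 = {}" using neM sub by blast
    qed
    moreover have "card (verts G) = card C + card ?D"
      using \<open>C \<subseteq> verts G\<close> by (metis card_Diff_subset card_mono finite_subset finite_verts le_add_diff_inverse)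
    ultimately show False using 1(3) 2(3) by simp
  qed
  then show ?thesis using assms by (auto simp: C_def)
qed

text \<open>A dominating edge could be added as a further branch set to a model in the rest of G.\<close>
lemma common_nonneighbour:
  assumes "v \<rightarrow> w"
  obtains z where "z \<in> verts G" "z \<noteq> v" "z \<noteq> w" "\<not> v \<rightarrow> z" "\<not> w \<rightarrow> z"
proof (rule ccontr)
  assume "\<not> thesis"
  then have dom: "v \<rightarrow> z \<or> w \<rightarrow> z" if "z \<in> verts G" "z \<noteq> v" "z \<noteq> w" for z
    using that \<open>\<And>z. \<lbrakk>z \<in> verts G; z \<noteq> v; z \<noteq> w; \<not> v \<rightarrow> z; \<not> w \<rightarrow> z\<rbrakk> \<Longrightarrow> thesis\<close> by blast
  have vw: "v \<in> verts G" "w \<in> verts G" "v \<noteq> w"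
    using assms adj_in_verts adj_not_same by blast+
  let ?S = "verts G - {v, w}"
  obtain F M where F: "clique_model G ?S F" and M: "matching (nonedges G ?S) M"
    and c: "card ?S \<le> card F + card M"
    using proper_subset_model_matching[of ?S] vw by blast
  have ne: "B \<noteq> {}" "B \<subseteq> ?S" if "B \<in> F" for B
    using F that connected_nonempty by (auto simp: clique_model_def)
  have adj: "\<exists>x\<in>{v, w}. \<exists>y\<in>B. x \<rightarrow> y \<and> y \<rightarrow> x" if "B \<in> F" for B
  proof -
    have "B \<noteq> {}" "B \<subseteq> ?S" using ne[OF that] by auto
    then obtain y where "y \<in> B" "y \<in> ?S" by blast
    then show ?thesis using dom[of y] adj_sym by blast
  qed
  have conn: "connected (G \<restriction> {v, w})"
    using vw assms adj_sym by (intro connected_clique) auto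
  have disj: "disjnt {v, w} B" if "B \<in> F" for B using ne[OF that] by auto
  have FG: "clique_model G (verts G) F" using F by (rule clique_model_mono) auto
  have "clique_model G (verts G) (insert {v, w} F)"
    unfolding clique_model_def
  proof (intro conjI ballI impI)
    fix B assume "B \<in> insert {v, w} F"
    then show "B \<subseteq> verts G" "connected (G \<restriction> B)"
      using FG conn vw by (auto simp: clique_model_def)
  next
    show "pairwise disjnt (insert {v, w} F)"
      using FG disj disjnt_sym by (simp add: pairwise_insert clique_model_def)
  next
    fix B C assume *: "B \<in> insert {v, w} F" "C \<in> insert {v, w} F" "B \<noteq> C"
    then consider "B \<in> F" "C \<in> F" | "B = {v, w}" "C \<in> F" | "C = {v, w}" "B \<in> F" by blast
    then show "\<exists>x\<in>B. \<exists>y\<in>C. x \<rightarrow> y"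
    proof cases
      case 1
      then show ?thesis using FG \<open>B \<noteq> C\<close> by (simp add: clique_model_def)
    next
      case 2
      then show ?thesis using adj[of C] by blast
    next
      case 3
      then show ?thesis using adj[of B] by blast
    qed
  qed
  moreover have "{v, w} \<notin> F" using ne by blast
  moreover have "finite F" using F finite_verts by (auto intro: finite_clique_model)
  ultimately have less: "Suc (card F) + card N < card (verts G)" if "matching E N" for N
    using model_matching_less[OF _ that, of "insert {v, w} F"] by simp
  have ME: "matching E M"
    using M nonedges_mono[of ?S "verts G" G] by (auto simp: matching_def)
  \<comment> \<open>With n vertices, \<open>less\<close> gives \<open>card F + card N\<close> \<le>
    n - 2 for every matching \<open>N\<close>, while \<open>card F + card M\<close> is at least n -
    2. So \<open>M\<close> is maximum in all of \<open>E\<close>.\<close>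
  have "card ?S = card (verts G) - 2" using vw by (simp add: card_Diff_subset)
  then have "card N \<le> card M" if "matching E N" for N using less[OF that] c by simp
  then have "maximum_matching E M" using ME by (simp add: maximum_matching_def)
  moreover have "v \<notin> \<Union>M" "w \<notin> \<Union>M" using M by (auto simp: matching_def nonedges_def)
  ultimately show False using maximum_matching_misses_one[OF vw] by blast
qed

text \<open>A maximum matching missing \<open>v\<close> misses nothing else, so it covers
  \<open>A\<close>. Each of its edges is a non-edge of G and meets the clique \<open>A\<close> at
  most once, so there are at least \<open>card A\<close> of them. The vertices outside
  \<open>A\<close>, as singletons, form a model; together the two sizes reach the number of
  vertices.\<close>

lemma not_two_cliques:
  assumes A: "A \<subseteq> verts G" "\<And>x y. x \<in> A \<Longrightarrow> y \<in> A \<Longrightarrow> x \<noteq> y \<Longrightarrow> x \<rightarrow> y"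
    and P: "\<And>x y. x \<in> verts G - A \<Longrightarrow> y \<in> verts G - A \<Longrightarrow> x \<noteq> y \<Longrightarrow> x \<rightarrow> y"
    and v: "v \<in> verts G - A"
  shows False
proof -
  obtain M where M: "maximum_matching E M" "v \<notin> \<Union>M" using missed_by_maximum v by blast
  then have ME: "matching E M" by (simp add: maximum_matching_def)
  have "A \<subseteq> \<Union>M" using maximum_matching_misses_one[OF _ _ _ M(1), of v] M(2) A(1) v by blast
  then have "\<forall>x\<in>A. \<exists>e. e \<in> M \<and> x \<in> e" by blast
  then obtain g where g: "\<And>x. x \<in> A \<Longrightarrow> g x \<in> M \<and> x \<in> g x" using bchoice by metis
  have "inj_on g A"
  proof (rule inj_onI)
    fix x y assume "x \<in> A" "y \<in> A" "g x = g y"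
    then have "x \<in> g x" "y \<in> g x" "g x \<in> E" using g ME by (auto simp: matching_def)
    then show "x = y" using A(2) \<open>x \<in> A\<close> \<open>y \<in> A\<close> adj_sym by (auto simp: nonedges_def)
  qed
  moreover have "finite M" using ME finite_E by (auto simp: matching_def intro: finite_subset)
  ultimately have "card A \<le> card M" using g by (intro card_inj_on_le[of g]) auto
  let ?F = "(\<lambda>x. {x}) ` (verts G - A)"
  have "clique_model G (verts G) ?F"
    using P by (auto simp: clique_model_def pairwise_def intro: connected_clique)
  then have "card ?F + card M < card (verts G)" using ME by (rule model_matching_less)
  moreover have "card ?F = card (verts G) - card A"
    using A(1) by (simp add: card_image card_Diff_subset finite_subset)
  ultimately show False using \<open>card A \<le> card M\<close> by linarith
qed

end

section \<open>The 5-cycle\<close>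

text \<open>Without parallel arcs an arc is determined by its ends, so a bijection of the vertices
  that respects adjacency extends to the arcs.\<close>

lemma (in nomulti_digraph) digraph_iso_with_projI:
  assumes f: "bij_betw f (verts G) (pverts K)"
    and adj: "\<And>u w. u \<in> verts G \<Longrightarrow> w \<in> verts G \<Longrightarrow> u \<rightarrow> w \<longleftrightarrow> (f u, f w) \<in> parcs K"
    and K: "parcs K \<subseteq> pverts K \<times> pverts K"
  shows "digraph_iso G (with_proj K)"
proof -
  \<comment> \<open>The arcs of \<open>with_proj K\<close> are pairs, so an arc goes to the pair of
    images of its ends, with \<open>fst\<close> as tail and \<open>snd\<close> as head.\<close>
  define h where "h = \<lparr> iso_verts = f, iso_arcs = (\<lambda>a. (f (tail G a), f (head G a))),
    iso_head = snd, iso_tail = fst \<rparr>"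
  have inj: "inj_on f (verts G)" and im: "f ` verts G = pverts K"
    using f by (auto simp: bij_betw_def)
  have "inj_on (iso_arcs h) (arcs G)"
  proof (rule inj_onI)
    fix a b assume ab: "a \<in> arcs G" "b \<in> arcs G" "iso_arcs h a = iso_arcs h b"
    then have "arc_to_ends G a = arc_to_ends G b"
      using inj by (auto simp: h_def arc_to_ends_def inj_on_def)
    then show "a = b" using no_multi_arcs ab by blast
  qed
  then have "digraph_isomorphism h"
    using inj wf_digraph by (auto simp: digraph_isomorphism_def h_def)
  moreover have "iso_arcs h ` arcs G = parcs K"
  proof
    show "iso_arcs h ` arcs G \<subseteq> parcs K"
    proof
      fix p assume "p \<in> iso_arcs h ` arcs G"
      then obtain a where a: "a \<in> arcs G" "p = (f (tail G a), f (head G a))"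
        by (auto simp: h_def)
      then have "tail G a \<rightarrow> head G a" by (auto simp: arcs_ends_conv)
      then show "p \<in> parcs K" using a adj by auto
    qed
    show "parcs K \<subseteq> iso_arcs h ` arcs G"
    proof
      fix p assume p: "p \<in> parcs K"
      then have "fst p \<in> f ` verts G" "snd p \<in> f ` verts G" using K im by auto
      then obtain u w where uw: "u \<in> verts G" "w \<in> verts G" "p = (f u, f w)"
        by (metis imageE prod.collapse)
      then have "u \<rightarrow> w" using adj p by blast
      then show "p \<in> iso_arcs h ` arcs G" using uw by (auto simp: h_def arcs_ends_conv)
    qed
  qed
  ultimately show ?thesis
    unfolding digraph_iso_def
    by (intro exI[of _ h]) (auto simp: app_iso_def with_proj_def h_def im)
qed

lemma (in graph) induced_5_cycle:
  assumes adj: "a \<rightarrow> b" "b \<rightarrow> c" "c \<rightarrow> d" "d \<rightarrow> e" "e \<rightarrow> a"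
    and nonadj: "\<not> a \<rightarrow> c" "\<not> b \<rightarrow> d" "\<not> c \<rightarrow> e" "\<not> d \<rightarrow> a" "\<not> e \<rightarrow> b"
  shows "\<exists>H. induced_subgraph H G \<and> a \<in> verts H \<and> digraph_iso H (cycle_graph 5)"
proof -
  let ?S = "{a, b, c, d, e}"
  have S: "?S \<subseteq> verts G" using adj adj_in_verts by blast
  have sym: "x \<rightarrow> y \<longleftrightarrow> y \<rightarrow> x" for x y using adj_sym by blast
  have irr: "\<not> x \<rightarrow> x" for x using adj_not_same by blast
  \<comment> \<open>Adjacent vertices differ because there are no loops; two non-adjacent ones
    differ because some third vertex is adjacent to exactly one of them.\<close>
  have neq: "a \<noteq> b" "a \<noteq> c" "a \<noteq> d" "a \<noteq> e" "b \<noteq> c" "b \<noteq> d" "b \<noteq> e" "c \<noteq> d" "c \<noteq> e" "d \<noteq> e"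
    using adj nonadj irr sym by metis+
  interpret H: graph "G \<restriction> ?S" by (rule graph_induce[OF S])
  define f :: "'a \<Rightarrow> nat" where
    "f x = (if x = a then 0 else if x = b then 1 else if x = c then 2 else if x = d then 3 else 4)"
    for x
  have f: "f a = 0" "f b = 1" "f c = 2" "f d = 3" "f e = 4" using neq by (auto simp: f_def)
  have "{..<5} = {0, 1, 2, 3, 4::nat}" by auto
  then have bij: "bij_betw f ?S {..<5}" using neq by (auto simp: bij_betw_def f)
  have adj': "b \<rightarrow> a" "c \<rightarrow> b" "d \<rightarrow> c" "e \<rightarrow> d" "a \<rightarrow> e"
    and nonadj': "\<not> c \<rightarrow> a" "\<not> d \<rightarrow> b" "\<not> e \<rightarrow> c" "\<not> a \<rightarrow> d" "\<not> b \<rightarrow> e"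
    using adj nonadj sym by metis+
  have "digraph_iso (G \<restriction> ?S) (cycle_graph 5)"
    unfolding cycle_graph_def
  proof (rule H.digraph_iso_with_projI[where f = f])
    show "bij_betw f (verts (G \<restriction> ?S)) (pverts \<lparr>pverts = {..<5},
        parcs = {(i, j). i < 5 \<and> j < 5 \<and> (j = Suc i mod 5 \<or> i = Suc j mod 5)}\<rparr>)"
      using bij by simp
  next
    fix u w assume "u \<in> verts (G \<restriction> ?S)" "w \<in> verts (G \<restriction> ?S)"
    then have uw: "u \<in> ?S" "w \<in> ?S" by auto
    then have "u \<rightarrow> w \<longleftrightarrow> (f w = Suc (f u) mod 5 \<or> f u = Suc (f w) mod 5)"
      using adj nonadj adj' nonadj' irr by (elim insertE emptyE) (simp_all add: f)
    moreover have "f u < 5" "f w < 5" by (simp_all add: f_def)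
    ultimately show "u \<rightarrow>\<^bsub>G \<restriction> ?S\<^esub> w \<longleftrightarrow> (f u, f w) \<in> parcs \<lparr>pverts = {..<5},
        parcs = {(i, j). i < 5 \<and> j < 5 \<and> (j = Suc i mod 5 \<or> i = Suc j mod 5)}\<rparr>"
      using uw by (simp add: adj_induce)
  qed auto
  then show ?thesis using induced_induce[OF S] by (intro exI[of _ "G \<restriction> ?S"]) auto
qed

theorem theorem4p3:
  fixes G :: "('a, 'b) pre_digraph"
  assumes "minimal_counterexample G" and "v \<in> verts G"
  shows "\<exists>H. induced_subgraph H G \<and> v \<in> verts H \<and> digraph_iso H (cycle_graph 5)"
proof -
  interpret graph G using assms(1) by (auto simp: minimal_counterexample_def counterexample_def)
  interpret min_counterexample G using assms(1) by unfold_locales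
  define A where "A = {a \<in> verts G. a \<noteq> v \<and> \<not> v \<rightarrow>\<^bsub>G\<^esub> a}"
  have A: "x \<rightarrow>\<^bsub>G\<^esub> y" if "x \<in> A" "y \<in> A" "x \<noteq> y" for x y
    using no_stable_triple[of v x y] that assms(2) by (auto simp: A_def)
  have v: "v \<in> verts G - A" using assms(2) by (simp add: A_def)
  have "A \<subseteq> verts G" by (auto simp: A_def)
  then have "\<not> (\<forall>x\<in>verts G - A. \<forall>y\<in>verts G - A. x \<noteq> y \<longrightarrow> x \<rightarrow>\<^bsub>G\<^esub> y)"
    using not_two_cliques[OF _ A _ v] by blast
  then obtain b c where b: "b \<in> verts G - A" and c: "c \<in> verts G - A"
    and bc: "b \<noteq> c" "\<not> b \<rightarrow>\<^bsub>G\<^esub> c" by blast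
  \<comment> \<open>Outside \<open>A\<close> every vertex other than \<open>v\<close> is a neighbour
    of \<open>v\<close>. As \<open>b\<close> and \<open>c\<close> are distinct and non-adjacent,
    neither can be \<open>v\<close>.\<close>
  have vb: "v \<rightarrow>\<^bsub>G\<^esub> b" and vc: "v \<rightarrow>\<^bsub>G\<^esub> c" using b c bc adj_sym by (auto simp: A_def)
  obtain b' where b': "b' \<in> verts G" "b' \<noteq> v" "b' \<noteq> b" "\<not> v \<rightarrow>\<^bsub>G\<^esub> b'" "\<not> b \<rightarrow>\<^bsub>G\<^esub> b'"
    using common_nonneighbour[OF vb] by blast
  obtain c' where c': "c' \<in> verts G" "c' \<noteq> v" "c' \<noteq> c" "\<not> v \<rightarrow>\<^bsub>G\<^esub> c'" "\<not> c \<rightarrow>\<^bsub>G\<^esub> c'"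
    using common_nonneighbour[OF vc] by blast
  \<comment> \<open>Here \<open>b\<close> is non-adjacent to both \<open>c\<close> and
    \<open>b'\<close>, and \<open>b'\<close> differs from \<open>c\<close> because only
    \<open>c\<close> is a neighbour of \<open>v\<close>; so \<open>b'\<close> and \<open>c\<close>
    are adjacent. The next line is the same with the roles exchanged.\<close>
  have b'c: "b' \<rightarrow>\<^bsub>G\<^esub> c" using no_stable_triple[of b c b'] b c b' bc vc adj_sym by blast
  have bc': "b \<rightarrow>\<^bsub>G\<^esub> c'" using no_stable_triple[of b c c'] b c c' bc vb adj_sym by blast
  \<comment> \<open>Only \<open>c'\<close> is a neighbour of \<open>b\<close>. Both vertices lie in
    the clique \<open>A\<close>.\<close>
  have "b' \<noteq> c'" using bc' b' by blast
  then have "c' \<rightarrow>\<^bsub>G\<^esub> b'" using A b' c' by (auto simp: A_def)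
  \<comment> \<open>The cycle runs through \<open>v\<close>, \<open>b\<close>, \<open>c'\<close>,
    \<open>b'\<close>, \<open>c\<close> in this order.\<close>
  show ?thesis
    by (rule induced_5_cycle[OF vb bc' \<open>c' \<rightarrow>\<^bsub>G\<^esub> b'\<close> b'c])
      (use vc bc b' c' adj_sym in blast)+
qed

end
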